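(* Let $k\geq 2$ be an integer and let $G$ be an edge-colored graph on $n\geq 3k-2$ vertices. If $\delta^c(G)\geq \frac{n+k-1}{2}$, then $G$ contains $k$ rainbow triangles sharing one common edge.
   Context: An edge-colored graph is a simple graph $G$ with a coloring $c:E(G)\to\mathbb{N}$ of its edges (not necessarily proper). For a vertex $v$, the color degree $d^c(v)$ is the number of distinct colors appearing on edges incident with $v$, and $\delta^c(G)=\min\{d^c(v):v\in V(G)\}$. A triangle is rainbow if its three edges have pairwise distinct colors. *)

theory Defs
  imports Complex_Main
begin

locale finite_simple_graph =
  fixes V :: "'a set" and E :: "'a set set"
  assumes finite_vertices: "finite V"
    and edge_subset: "e \<in> E \<Longrightarrow> e \<subseteq> V"
    and edge_card: "e \<in> E \<Longrightarrow> card e = 2"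

text \<open>An edge colouring of a graph with edge set \<open>E\<close> is a function \<open>c\<close> on vertex sets, of which
  only the values on \<open>E\<close> are ever used.\<close>

definition color_degree :: "'a set set \<Rightarrow> ('a set \<Rightarrow> nat) \<Rightarrow> 'a \<Rightarrow> nat" where
  "color_degree E c v = card (c ` {e \<in> E. v \<in> e})"

text \<open>Only meaningful for finite nonempty \<open>V\<close>, since \<open>Min\<close> is unspecified otherwise.\<close>

definition min_color_degree :: "'a set \<Rightarrow> 'a set set \<Rightarrow> ('a set \<Rightarrow> nat) \<Rightarrow> nat" where
  "min_color_degree V E c = Min (color_degree E c ` V)"

text \<open>In a simple graph a triangle is determined by its vertex set, so triangles are
  represented by their vertex sets.\<close>

definition rainbow_triangle :: "'a set set \<Rightarrow> ('a set \<Rightarrow> nat) \<Rightarrow> 'a set \<Rightarrow> bool" where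
  "rainbow_triangle E c T \<longleftrightarrow>
    (\<exists>x y z. T = {x, y, z} \<and> x \<noteq> y \<and> y \<noteq> z \<and> x \<noteq> z \<and>
       {x, y} \<in> E \<and> {y, z} \<in> E \<and> {x, z} \<in> E \<and>
       c {x, y} \<noteq> c {y, z} \<and> c {y, z} \<noteq> c {x, z} \<and> c {x, y} \<noteq> c {x, z})"

end

theory Submission
  imports Defs
begin

text \<open>Every non-rainbow triangle contains two edges of the same colour at a common vertex. If no
  edge lies in \<open>k\<close> rainbow triangles, counting the triangles on all edges therefore gives
  \<open>\<Sum>v. d v * (2 * d v - n - k + 1) \<le> 3 * (\<Sum>v. p v)\<close>, where \<open>d v\<close> is the degree and \<open>p v\<close> the
  number of ordered pairs of distinct equally coloured edges at \<open>v\<close>. With \<open>t = d v - d\<^sup>c v\<close> one has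
  \<open>p v \<le> t * (t + 1)\<close>, which is so small compared with \<open>d v * 2 * t\<close> that equality must hold
  throughout: the graph is regular of degree \<open>(n + k - 1) / 2\<close>, and the non-neighbourhoods of
  adjacent vertices are disjoint. Three of these, taken at the corners of a triangle, cover
  \<open>3 * (n - k + 1) / 2 > n\<close> vertices, a contradiction.\<close>

lemma card_monochromatic_pairs_le:
  assumes "finite A"
  shows "(\<Sum>a\<in>A. card {b \<in> A. b \<noteq> a \<and> f b = f a})
    \<le> (card A - card (f ` A)) * (card A - card (f ` A) + 1)"
proof -
  define m where "m i = card {b \<in> A. f b = i}" for i
  define t where "t = (\<Sum>i\<in>f ` A. m i - 1)"
  have m_pos: "1 \<le> m i" if "i \<in> f ` A" for i
    using that assms by (auto simp: m_def Suc_le_eq card_gt_0_iff)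
  have sum_m: "(\<Sum>i\<in>f ` A. m i) = card A"
    using sum.image_gen[OF assms, of "\<lambda>_. 1::nat" f] by (simp add: m_def)
  have t: "t = card A - card (f ` A)"
    unfolding t_def using m_pos by (subst sum_subtractf_nat) (auto simp: sum_m)
  have m_le: "m i \<le> t + 1" if "i \<in> f ` A" for i
    using member_le_sum[of i "f ` A" "\<lambda>i. m i - 1"] that assms by (simp add: t_def)
  have "card {b \<in> A. b \<noteq> a \<and> f b = f a} = m (f a) - 1" if "a \<in> A" for a
  proof -
    have "{b \<in> A. b \<noteq> a \<and> f b = f a} = {b \<in> A. f b = f a} - {a}"
      by auto
    then show ?thesis
      using that assms by (simp add: m_def)
  qed
  then have "(\<Sum>a\<in>A. card {b \<in> A. b \<noteq> a \<and> f b = f a}) = (\<Sum>a\<in>A. m (f a) - 1)"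
    by simp
  also have "\<dots> = (\<Sum>i\<in>f ` A. m i * (m i - 1))"
    by (subst sum.image_gen[OF assms, of _ f]) (simp add: m_def)
  also have "\<dots> \<le> (\<Sum>i\<in>f ` A. (t + 1) * (m i - 1))"
    using m_le by (intro sum_mono mult_right_mono) auto
  also have "\<dots> = t * (t + 1)"
    unfolding sum_distrib_left[symmetric] t_def[symmetric] by simp
  finally show ?thesis
    unfolding t .
qed

section \<open>Neighbourhoods, codegree counting and the extremal case\<close>

context finite_simple_graph
begin

definition nbrs :: "'a \<Rightarrow> 'a set" where
  "nbrs v = {w. {v, w} \<in> E}"

definition rainbow_apexes :: "('a set \<Rightarrow> nat) \<Rightarrow> 'a \<Rightarrow> 'a \<Rightarrow> 'a set" where
  "rainbow_apexes c u v = {w \<in> nbrs u \<inter> nbrs v.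
     c {u, v} \<noteq> c {u, w} \<and> c {u, v} \<noteq> c {v, w} \<and> c {u, w} \<noteq> c {v, w}}"

definition mono_pairs :: "('a set \<Rightarrow> nat) \<Rightarrow> 'a \<Rightarrow> nat" where
  "mono_pairs c v = (\<Sum>u\<in>nbrs v. card {w \<in> nbrs v. w \<noteq> u \<and> c {v, w} = c {v, u}})"

lemma nbrs_subset: "nbrs v \<subseteq> V"
  unfolding nbrs_def using edge_subset by auto

lemma finite_nbrs: "finite (nbrs v)"
  using nbrs_subset finite_vertices finite_subset by blast

lemma not_self_nbr: "v \<notin> nbrs v"
  unfolding nbrs_def using edge_card[of "{v, v}"] by auto

lemma nbrs_sym: "u \<in> nbrs v \<longleftrightarrow> v \<in> nbrs u"
  by (simp add: nbrs_def insert_commute)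

lemma color_degree_nbrs: "color_degree E c v = card ((\<lambda>w. c {v, w}) ` nbrs v)"
proof -
  have "{e \<in> E. v \<in> e} = (\<lambda>w. {v, w}) ` nbrs v"
  proof (intro equalityI subsetI)
    fix e assume e: "e \<in> {e \<in> E. v \<in> e}"
    then obtain x y where "e = {x, y}"
      using edge_card[of e] by (auto simp: card_2_iff)
    with e show "e \<in> (\<lambda>w. {v, w}) ` nbrs v"
      by (auto simp: nbrs_def insert_commute)
  qed (auto simp: nbrs_def)
  then show ?thesis
    by (simp add: color_degree_def image_image)
qed

text \<open>Adjacency is symmetric, so reversing every ordered edge permutes the index set.\<close>

lemma sum_nbrs_swap:
  "(\<Sum>u\<in>V. \<Sum>v\<in>nbrs u. f u v) = (\<Sum>u\<in>V. \<Sum>v\<in>nbrs u. f v u)"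
proof -
  have *: "{v \<in> V. v \<in> nbrs u} = nbrs u" for u
    using nbrs_subset by auto
  have **: "{u \<in> V. v \<in> nbrs u} = nbrs v" for v
    using nbrs_subset nbrs_sym by auto
  have "(\<Sum>u\<in>V. \<Sum>v\<in>nbrs u. f u v) = (\<Sum>u\<in>V. \<Sum>v\<in>{v \<in> V. v \<in> nbrs u}. f u v)"
    unfolding * ..
  also have "\<dots> = (\<Sum>v\<in>V. \<Sum>u\<in>{u \<in> V. v \<in> nbrs u}. f u v)"
    by (rule sum.swap_restrict) (auto simp: finite_vertices)
  also have "\<dots> = (\<Sum>v\<in>V. \<Sum>u\<in>nbrs v. f u v)"
    unfolding ** ..
  finally show ?thesis .
qed

text \<open>If a triangle \<open>u\<close>, \<open>v\<close>, \<open>w\<close> is not rainbow, two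
  of its edges agree in colour and meet at one of the three corners. Each choice of corner costs at
  most one copy of the sum of \<open>mono_pairs\<close>, whence the factor 3.\<close>

lemma sum_codegree_le:
  "(\<Sum>u\<in>V. \<Sum>v\<in>nbrs u. card (nbrs u \<inter> nbrs v))
    \<le> (\<Sum>u\<in>V. \<Sum>v\<in>nbrs u. card (rainbow_apexes c u v)) + 3 * (\<Sum>v\<in>V. mono_pairs c v)"
proof -
  \<comment> \<open>The repeated colour is at the apex \<open>w\<close> for \<open>B1 u v\<close>,
    at \<open>u\<close> for \<open>B2 u v\<close> and at \<open>v\<close> for
    \<open>B2 v u\<close>.\<close>
  define B1 where "B1 u v = {w \<in> nbrs u \<inter> nbrs v. c {w, u} = c {w, v}}" for u v
  define B2 where "B2 u v = {w \<in> nbrs u \<inter> nbrs v. c {u, w} = c {u, v}}" for u v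
  have fin: "finite (rainbow_apexes c u v)" "finite (B1 u v)" "finite (B2 u v)" for u v
    by (auto simp: rainbow_apexes_def B1_def B2_def finite_nbrs)
  have "card (nbrs u \<inter> nbrs v)
    \<le> card (rainbow_apexes c u v) + card (B1 u v) + card (B2 u v) + card (B2 v u)" for u v
  proof -
    have "nbrs u \<inter> nbrs v \<subseteq> rainbow_apexes c u v \<union> B1 u v \<union> B2 u v \<union> B2 v u"
      by (auto simp: rainbow_apexes_def B1_def B2_def insert_commute)
    then have "card (nbrs u \<inter> nbrs v)
      \<le> card (rainbow_apexes c u v \<union> B1 u v \<union> B2 u v \<union> B2 v u)"
      using fin by (intro card_mono) auto
    also have "\<dots> \<le> card (rainbow_apexes c u v) + card (B1 u v) + card (B2 u v) + card (B2 v u)"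
      by (meson card_Un_le add_mono le_refl order_trans)
    finally show ?thesis .
  qed
  then have "(\<Sum>u\<in>V. \<Sum>v\<in>nbrs u. card (nbrs u \<inter> nbrs v))
    \<le> (\<Sum>u\<in>V. \<Sum>v\<in>nbrs u.
        card (rainbow_apexes c u v) + card (B1 u v) + card (B2 u v) + card (B2 v u))"
    by (intro sum_mono) auto
  also have "\<dots> = (\<Sum>u\<in>V. \<Sum>v\<in>nbrs u. card (rainbow_apexes c u v))
      + (\<Sum>u\<in>V. \<Sum>v\<in>nbrs u. card (B1 u v))
      + (\<Sum>u\<in>V. \<Sum>v\<in>nbrs u. card (B2 u v)) + (\<Sum>u\<in>V. \<Sum>v\<in>nbrs u. card (B2 v u))"
    by (simp add: sum.distrib)
  finally have sum_le: "(\<Sum>u\<in>V. \<Sum>v\<in>nbrs u. card (nbrs u \<inter> nbrs v)) \<le> \<dots>" .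
  have B2: "(\<Sum>u\<in>V. \<Sum>v\<in>nbrs u. card (B2 u v)) \<le> (\<Sum>v\<in>V. mono_pairs c v)"
    unfolding mono_pairs_def B2_def
    by (intro sum_mono card_mono) (auto simp: finite_nbrs not_self_nbr)
  have B2': "(\<Sum>u\<in>V. \<Sum>v\<in>nbrs u. card (B2 v u)) \<le> (\<Sum>v\<in>V. mono_pairs c v)"
    using B2 sum_nbrs_swap[of "\<lambda>u v. card (B2 u v)"] by simp
  \<comment> \<open>Here the repeated colour is at the innermost index \<open>w\<close>, so the
    triples are re-rooted at \<open>w\<close> by an injection.\<close>
  define S where "S = (SIGMA u:V. SIGMA v:nbrs u. B1 u v)"
  define S' where
    "S' = (SIGMA w:V. SIGMA u:nbrs w. {v \<in> nbrs w. v \<noteq> u \<and> c {w, v} = c {w, u}})"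
  have "(\<Sum>u\<in>V. \<Sum>v\<in>nbrs u. card (B1 u v)) = card S"
    using finite_vertices by (simp add: S_def finite_nbrs fin)
  also have "card S \<le> card S'"
  proof (rule card_inj_on_le)
    show "inj_on (\<lambda>(u, v, w). (w, u, v)) S"
      by (auto simp: inj_on_def)
    show "(\<lambda>(u, v, w). (w, u, v)) ` S \<subseteq> S'"
    proof clarify
      fix u v w assume "(u, v, w) \<in> S"
      then have "v \<in> nbrs u" "w \<in> nbrs u" "w \<in> nbrs v" "c {w, u} = c {w, v}"
        by (auto simp: S_def B1_def)
      moreover have "w \<in> V" "u \<in> nbrs w" "v \<in> nbrs w"
        using calculation nbrs_subset nbrs_sym by blast+
      moreover have "u \<noteq> v"
        using calculation not_self_nbr by blast
      ultimately show "(w, u, v) \<in> S'"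
        by (simp add: S'_def)
    qed
    show "finite S'"
      using finite_vertices by (auto simp: S'_def finite_nbrs)
  qed
  also have "card S' = (\<Sum>v\<in>V. mono_pairs c v)"
    using finite_vertices by (simp add: S'_def mono_pairs_def finite_nbrs)
  finally show ?thesis
    using sum_le B2 B2' by linarith
qed

text \<open>Each non-neighbourhood \<open>S v\<close> has \<open>(card V - k + 1) / 2\<close>
  elements. The three at the corners of a triangle are disjoint, so
  \<open>3 * (card V - k + 1)\<close> is at most \<open>2 * card V\<close>.\<close>

lemma card_vertices_bound_of_covering_edges:
  assumes deg: "\<And>v. v \<in> V \<Longrightarrow> 2 * card (nbrs v) + 1 = card V + k"
    and cover: "\<And>u v. v \<in> nbrs u \<Longrightarrow> nbrs u \<union> nbrs v = V"
    and "k \<ge> 2"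
    and "V \<noteq> {}"
  shows "card V + 3 \<le> 3 * k"
proof -
  define S where "S v = V - nbrs v" for v
  have card_S: "2 * card (S v) + k = card V + 1" if "v \<in> V" for v
    using deg[OF that] card_mono[OF finite_vertices nbrs_subset[of v]] finite_nbrs[of v]
    by (simp add: S_def card_Diff_subset nbrs_subset)
  have disj: "S u \<inter> S v = {}" if "v \<in> nbrs u" for u v
    using cover[OF that] by (auto simp: S_def)
  obtain u where u: "u \<in> V"
    using \<open>V \<noteq> {}\<close> by blast
  then have "nbrs u \<noteq> {}"
    using deg[OF u] \<open>k \<ge> 2\<close> by auto
  then obtain v where v: "v \<in> nbrs u" "v \<in> V"
    using nbrs_subset by blast
  have "card (nbrs u \<union> nbrs v) + card (nbrs u \<inter> nbrs v) = card (nbrs u) + card (nbrs v)"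
    using card_Un_Int[OF finite_nbrs finite_nbrs] by simp
  \<comment> \<open>The two degrees add up to \<open>card V + k - 1\<close> while the union is
    \<open>V\<close>, so there are \<open>k - 1 \<ge> 1\<close> common neighbours and
    \<open>u\<close>, \<open>v\<close> extend to a triangle.\<close>
  then have "card (nbrs u \<inter> nbrs v) \<noteq> 0"
    using cover[OF v(1)] deg[OF u] deg[OF v(2)] \<open>k \<ge> 2\<close> by simp
  then have "nbrs u \<inter> nbrs v \<noteq> {}"
    by auto
  then obtain w where w: "w \<in> nbrs u" "w \<in> nbrs v" "w \<in> V"
    using nbrs_subset by blast
  have fin: "finite (S x)" for x
    using finite_vertices by (simp add: S_def)
  have "card (S u) + card (S v) + card (S w) = card (S u \<union> S v \<union> S w)"
    using disj[OF v(1)] disj[OF w(1)] disj[OF w(2)] fin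
    by (subst card_Un_disjoint; (subst card_Un_disjoint)?) auto
  also have "\<dots> \<le> card V"
    using finite_vertices by (intro card_mono) (auto simp: S_def)
  finally show ?thesis
    using card_S[OF u] card_S[OF v(2)] card_S[OF w(3)] by linarith
qed

lemma exists_edge_many_rainbow_apexes:
  assumes "k \<ge> 2"
    and large: "3 * k \<le> card V + 2"
    and cdeg: "\<And>v. v \<in> V \<Longrightarrow> card V + k \<le> 2 * color_degree E c v + 1"
  shows "\<exists>u\<in>V. \<exists>v\<in>nbrs u. k \<le> card (rainbow_apexes c u v)"
proof (rule ccontr)
  assume contr: "\<not> ?thesis"
  define n where "n = int (card V)"
  define d where "d v = int (card (nbrs v))" for v
  define p where "p v = int (mono_pairs c v)" for v
  \<comment> \<open>\<open>h v\<close> is the share of \<open>v\<close> in the counting inequality;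
    the term \<open>int k - 1\<close> bounds the apexes on each edge.\<close>
  define h where "h v = d v * (2 * d v - n - int k + 1) - 3 * p v" for v
  define cod where "cod u v = int (card (nbrs u \<inter> nbrs v))" for u v
  have cod_ge: "d u + d v - n \<le> cod u v"
    and cod_eq: "cod u v = d u + d v - n \<Longrightarrow> nbrs u \<union> nbrs v = V"
    for u v
  proof -
    have un: "card (nbrs u) + card (nbrs v) = card (nbrs u \<union> nbrs v) + card (nbrs u \<inter> nbrs v)"
      using card_Un_Int[OF finite_nbrs finite_nbrs] .
    have sub: "nbrs u \<union> nbrs v \<subseteq> V"
      using nbrs_subset by blast
    show "d u + d v - n \<le> cod u v"
      using un card_mono[OF finite_vertices sub] unfolding d_def n_def cod_def by linarith
    show "nbrs u \<union> nbrs v = V" if "cod u v = d u + d v - n"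
      using un that card_subset_eq[OF finite_vertices sub] unfolding d_def n_def cod_def by linarith
  qed
  have h_facts: "0 \<le> h v \<and> (h v = 0 \<longrightarrow> 2 * d v = n + int k - 1)" if v: "v \<in> V" for v
  proof -
    define q where "q = int (color_degree E c v)"
    define t where "t = d v - q"
    have t0: "0 \<le> t"
      using card_image_le[OF finite_nbrs] by (simp add: t_def q_def d_def color_degree_nbrs)
    have pt: "p v \<le> t * (t + 1)"
    proof -
      define s where "s = card (nbrs v) - color_degree E c v"
      have "mono_pairs c v \<le> s * (s + 1)"
        unfolding mono_pairs_def s_def color_degree_nbrs
        using card_monochromatic_pairs_le[OF finite_nbrs, where f = "\<lambda>w. c {v, w}"] .
      moreover have "int s = t"
        using t0 by (simp add: s_def t_def d_def q_def)
      moreover have "int (s * (s + 1)) = int s * (int s + 1)"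
        by (simp only: of_nat_mult of_nat_add of_nat_1)
      ultimately show ?thesis
        unfolding p_def using of_nat_mono[of "mono_pairs c v" "s * (s + 1)", where 'a = int] by argo
    qed
    have q: "n + int k - 1 \<le> 2 * q"
      using cdeg[OF v] by (simp add: q_def n_def)
    have "nbrs v \<subset> V"
      using nbrs_subset[of v] not_self_nbr[of v] v by blast
    then have "card (nbrs v) < card V"
      by (rule psubset_card_mono[OF finite_vertices])
    then have dn: "d v \<le> n - 1"
      by (simp add: d_def n_def)
    have n4: "3 * int k - 2 \<le> n" "4 \<le> n"
      using large \<open>k \<ge> 2\<close> by (simp_all add: n_def)
    \<comment> \<open>\<open>x\<close> is the slack in the colour degree bound at \<open>v\<close>,
      and \<open>2 * d v - (n + int k - 1) = x + 2 * t\<close>.\<close>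
    define x where "x = 2 * q - (n + int k - 1)"
    have "0 \<le> x" "0 < d v"
      using q t0 n4 by (simp_all add: x_def t_def)
    \<comment> \<open>The right side is \<open>3 * q - d v - 3\<close>; its double is at least
      \<open>n + 3 * int k - 7\<close>, which is at least 3.\<close>
    have "1 \<le> 2 * d v - 3 * (t + 1)"
      using q dn n4 \<open>k \<ge> 2\<close> by (simp add: t_def)
    have "h v = d v * x + 2 * d v * t - 3 * p v"
      by (simp add: h_def x_def t_def algebra_simps)
    also have "\<dots> \<ge> d v * x + t * (2 * d v - 3 * (t + 1))"
      using pt by (simp add: algebra_simps)
    finally have *: "d v * x + t * (2 * d v - 3 * (t + 1)) \<le> h v" .
    moreover have a: "0 \<le> d v * x" and b: "0 \<le> t * (2 * d v - 3 * (t + 1))"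
      using \<open>0 \<le> x\<close> \<open>0 < d v\<close> t0 \<open>1 \<le> 2 * d v - 3 * (t + 1)\<close> by simp_all
    moreover have "2 * d v = n + int k - 1" if "h v = 0"
    proof -
      have "d v * x = 0" "t * (2 * d v - 3 * (t + 1)) = 0"
        using * a b that by linarith+
      then have "x = 0" "t = 0"
        using \<open>0 < d v\<close> \<open>1 \<le> 2 * d v - 3 * (t + 1)\<close> by auto
      then show ?thesis
        by (simp add: x_def t_def)
    qed
    ultimately show ?thesis
      by linarith
  qed
  have degree_sum: "(\<Sum>u\<in>V. \<Sum>v\<in>nbrs u. d u + d v - n) = (\<Sum>u\<in>V. d u * (2 * d u - n))"
  proof -
    have "(\<Sum>u\<in>V. \<Sum>v\<in>nbrs u. d v) = (\<Sum>u\<in>V. d u * d u)"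
      using sum_nbrs_swap[of "\<lambda>u v. d v"] by (simp add: d_def)
    moreover have "(\<Sum>v\<in>nbrs u. d u + d v - n) = d u * (d u - n) + (\<Sum>v\<in>nbrs u. d v)" for u
      by (simp add: sum.distrib sum_subtractf d_def right_diff_distrib)
    ultimately have "(\<Sum>u\<in>V. \<Sum>v\<in>nbrs u. d u + d v - n)
      = (\<Sum>u\<in>V. d u * (d u - n)) + (\<Sum>u\<in>V. d u * d u)"
      by (simp add: sum.distrib)
    also have "\<dots> = (\<Sum>u\<in>V. d u * (2 * d u - n))"
      unfolding sum.distrib[symmetric] by (simp add: algebra_simps)
    finally show ?thesis .
  qed
  have cod_sum: "(\<Sum>u\<in>V. \<Sum>v\<in>nbrs u. cod u v)
    \<le> (\<Sum>u\<in>V. \<Sum>v\<in>nbrs u. int k - 1) + 3 * (\<Sum>v\<in>V. p v)"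
  proof -
    have "(\<Sum>u\<in>V. \<Sum>v\<in>nbrs u. cod u v)
      \<le> (\<Sum>u\<in>V. \<Sum>v\<in>nbrs u. int (card (rainbow_apexes c u v))) + 3 * (\<Sum>v\<in>V. p v)"
      unfolding cod_def p_def using of_nat_mono[OF sum_codegree_le[of c], where 'a = int]
      by simp
    also have "(\<Sum>u\<in>V. \<Sum>v\<in>nbrs u. int (card (rainbow_apexes c u v)))
      \<le> (\<Sum>u\<in>V. \<Sum>v\<in>nbrs u. int k - 1)"
      using contr by (intro sum_mono) fastforce
    finally show ?thesis by simp
  qed
  \<comment> \<open>Both sums consist of nonnegative terms, so this bound forces every term to
    vanish: \<open>h v = 0\<close> fixes the degrees, and tight codegrees make \<open>nbrs u\<close>
    and \<open>nbrs v\<close> cover \<open>V\<close> for adjacent \<open>u\<close>,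
    \<open>v\<close>.\<close>
  have slack: "(\<Sum>u\<in>V. \<Sum>v\<in>nbrs u. cod u v - (d u + d v - n)) + (\<Sum>v\<in>V. h v) \<le> 0"
  proof -
    have "(\<Sum>v\<in>V. h v) = (\<Sum>u\<in>V. d u * (2 * d u - n))
        - (\<Sum>u\<in>V. d u * (int k - 1)) - 3 * (\<Sum>v\<in>V. p v)"
      unfolding h_def sum_distrib_left sum_subtractf[symmetric]
      by (simp add: algebra_simps)
    moreover have "(\<Sum>u\<in>V. \<Sum>v\<in>nbrs u. int k - 1) = (\<Sum>u\<in>V. d u * (int k - 1))"
      by (simp add: d_def)
    moreover have "(\<Sum>u\<in>V. \<Sum>v\<in>nbrs u. cod u v - (d u + d v - n))
      = (\<Sum>u\<in>V. \<Sum>v\<in>nbrs u. cod u v) - (\<Sum>u\<in>V. \<Sum>v\<in>nbrs u. d u + d v - n)"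
      by (simp add: sum_subtractf)
    ultimately show ?thesis
      using cod_sum degree_sum by linarith
  qed
  have inner_ge: "0 \<le> (\<Sum>v\<in>nbrs u. cod u v - (d u + d v - n))" for u
    using cod_ge by (intro sum_nonneg) simp
  have h_sum: "0 \<le> (\<Sum>v\<in>V. h v)"
    using h_facts by (intro sum_nonneg) blast
  have cod_sum_ge: "0 \<le> (\<Sum>u\<in>V. \<Sum>v\<in>nbrs u. cod u v - (d u + d v - n))"
    by (rule sum_nonneg) (rule inner_ge)
  have "(\<Sum>v\<in>V. h v) = 0"
    using slack h_sum cod_sum_ge by linarith
  then have "h v = 0" if "v \<in> V" for v
    using sum_nonneg_eq_0_iff[OF finite_vertices, of h] h_facts that by blast
  then have deg: "2 * card (nbrs v) + 1 = card V + k" if "v \<in> V" for v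
    using h_facts[OF that] that unfolding d_def n_def by force
  have "(\<Sum>u\<in>V. \<Sum>v\<in>nbrs u. cod u v - (d u + d v - n)) = 0"
    using slack h_sum cod_sum_ge by linarith
  then have inner_zero: "(\<Sum>v\<in>nbrs u. cod u v - (d u + d v - n)) = 0" if "u \<in> V" for u
    by (rule sum_nonneg_0[OF finite_vertices inner_ge _ that])
  have tight: "cod u v - (d u + d v - n) = 0" if "u \<in> V" "v \<in> nbrs u" for u v
  proof (rule sum_nonneg_0[OF finite_nbrs _ inner_zero])
    show "0 \<le> cod u w - (d u + d w - n)" for w
      using cod_ge[of u w] by linarith
  qed (fact that)+
  have cover: "nbrs u \<union> nbrs v = V" if "v \<in> nbrs u" for u v
  proof (rule cod_eq)
    have "u \<in> V"
      using that nbrs_subset nbrs_sym by blast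
    then show "cod u v = d u + d v - n"
      using tight[of u v] that by linarith
  qed
  have "V \<noteq> {}"
    using large \<open>k \<ge> 2\<close> by auto
  from card_vertices_bound_of_covering_edges[OF deg cover \<open>k \<ge> 2\<close> this] large show False
    by linarith
qed

section \<open>From apexes to a family of rainbow triangles\<close>

lemma rainbow_triangle_apex:
  assumes "v \<in> nbrs u" and "w \<in> rainbow_apexes c u v"
  shows "rainbow_triangle E c {u, v, w}"
proof -
  have "u \<noteq> v" "v \<noteq> w" "u \<noteq> w"
    using assms not_self_nbr by (auto simp: rainbow_apexes_def)
  then show ?thesis
    unfolding rainbow_triangle_def using assms
    by (intro exI[of _ u] exI[of _ v] exI[of _ w]) (auto simp: rainbow_apexes_def nbrs_def)
qed

end

theorem theorem3:
  fixes V :: "'a set" and E :: "'a set set" and c :: "'a set \<Rightarrow> nat" and n k :: nat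
  assumes "k \<ge> 2"
    and "finite_simple_graph V E"
    and "card V = n"
    and "n \<ge> 3 * k - 2"
    and "real (min_color_degree V E c) \<ge> (real n + real k - 1) / 2"
  shows "\<exists>e \<in> E. \<exists>\<T>. finite \<T> \<and> card \<T> = k \<and> (\<forall>T \<in> \<T>. rainbow_triangle E c T \<and> e \<subseteq> T)"
proof -
  interpret finite_simple_graph V E
    by fact
  have cdeg: "card V + k \<le> 2 * color_degree E c v + 1" if "v \<in> V" for v
  proof -
    have "min_color_degree V E c \<le> color_degree E c v"
      unfolding min_color_degree_def using that finite_vertices by simp
    then have "real n + real k \<le> 2 * real (color_degree E c v) + 1"
      using assms(5) by simp
    then show ?thesis
      using assms(3) by linarith
  qed
  \<comment> \<open>Truncated subtraction is harmless: \<open>n \<ge> 3 * k - 2\<close> is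
    equivalent to this form on the naturals.\<close>
  have "3 * k \<le> card V + 2"
    using assms(3,4) by linarith
  from exists_edge_many_rainbow_apexes[OF assms(1) this cdeg]
  obtain u v where uv: "v \<in> nbrs u" and "k \<le> card (rainbow_apexes c u v)"
    by blast
  then obtain W where W: "W \<subseteq> rainbow_apexes c u v" "card W = k" "finite W"
    using obtain_subset_with_card_n by metis
  have "u \<notin> rainbow_apexes c u v" "v \<notin> rainbow_apexes c u v"
    by (simp_all add: rainbow_apexes_def not_self_nbr)
  with W(1) have "u \<notin> W" "v \<notin> W"
    by blast+
  \<comment> \<open>As \<open>w\<close> differs from \<open>u\<close> and \<open>v\<close>, it can
    be recovered from the vertex set of its triangle, so distinct apexes give distinct
    triangles.\<close>
  then have "inj_on (\<lambda>w. {u, v, w}) W"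
    by (intro inj_onI) (metis insertCI insertE singletonD)
  then have "card ((\<lambda>w. {u, v, w}) ` W) = k"
    using W(2) by (simp add: card_image)
  moreover have "{u, v} \<in> E"
    using uv by (simp add: nbrs_def)
  ultimately show ?thesis
    using W rainbow_triangle_apex[OF uv]
    by (intro bexI[of _ "{u, v}"] exI[of _ "(\<lambda>w. {u, v, w}) ` W"]) auto
qed

end
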